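(* Let $ABCD$ be a square, let $E$ be the midpoint of the side $\overline{AB}$ and $F$ the midpoint of the side $\overline{CD}$, so that $\overline{EF}$ is a midline of the square and $\overline{BF}$ is a diagonal of the rectangle $EBCF$. Let $\beta=\angle(FBA)$ be the angle with vertex $B$ between the rays $\overrightarrow{BF}$ and $\overrightarrow{BA}$. Then the bisector of $\beta$ meets the side $\overline{AD}$ in a point $G$ that divides $\overline{AD}$ in the golden section, i.e. $\dfrac{AG}{GD}=\dfrac{AD}{AG}=\Phi$.
   Context: The vertices $A,B,C,D$ of the square are listed in cyclic order. $XY$ denotes the length of the segment $\overline{XY}$. A point $G$ divides a segment in the golden section if the ratio of the larger part to the smaller part equals the ratio of the whole segment to the larger part; this common ratio is $\Phi=\frac12(1+\sqrt5)$. *)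

theory Defs
  imports "HOL-Analysis.Analysis"
begin

text \<open>Undirected angle \<open>\<angle>(XYZ)\<close> at the vertex \<open>Y\<close>, with values between 0 and \<open>pi\<close>.
  If \<open>X = Y\<close> or \<open>Z = Y\<close>, the value is the junk value \<open>arccos 0 = pi/2\<close>, hence the
  distinctness conditions below.\<close>

definition angle :: "real^2 \<Rightarrow> real^2 \<Rightarrow> real^2 \<Rightarrow> real" where
  "angle X Y Z = arccos (((X - Y) \<bullet> (Z - Y)) / (norm (X - Y) * norm (Z - Y)))"

text \<open>Four right angles suffice here because we are in the plane: they force the opposite sides to
  be parallel. In particular the vertices are in cyclic order.\<close>

definition is_rectangle :: "real^2 \<Rightarrow> real^2 \<Rightarrow> real^2 \<Rightarrow> real^2 \<Rightarrow> bool" where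
  "is_rectangle A B C D \<longleftrightarrow> distinct [A, B, C, D] \<and>
     angle D A B = pi / 2 \<and> angle A B C = pi / 2 \<and>
     angle B C D = pi / 2 \<and> angle C D A = pi / 2"

definition is_square :: "real^2 \<Rightarrow> real^2 \<Rightarrow> real^2 \<Rightarrow> real^2 \<Rightarrow> bool" where
  "is_square A B C D \<longleftrightarrow> is_rectangle A B C D \<and>
     dist A B = dist B C \<and> dist B C = dist C D \<and> dist C D = dist D A"

text \<open>The bisector of the angle \<open>\<angle>(XYZ)\<close> is the ray from \<open>Y\<close>, vertex included, that divides
  the angle into two equal halves, where \<open>X\<close> and \<open>Z\<close> differ from \<open>Y\<close>. (For a straight angle the set consists of both perpendicular
  rays.)\<close>

definition angle_bisector :: "real^2 \<Rightarrow> real^2 \<Rightarrow> real^2 \<Rightarrow> (real^2) set" where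
  "angle_bisector X Y Z =
     insert Y {P. P \<noteq> Y \<and> angle X Y P = angle X Y Z / 2 \<and> angle P Y Z = angle X Y Z / 2}"

definition golden_ratio :: real where
  "golden_ratio = (1 + sqrt 5) / 2"

definition divides_in_golden_section :: "real^2 \<Rightarrow> real^2 \<Rightarrow> real^2 \<Rightarrow> bool" where
  "divides_in_golden_section G X Y \<longleftrightarrow> G \<in> open_segment X Y \<and>
     (let larger = max (dist X G) (dist G Y); smaller = min (dist X G) (dist G Y)
      in larger / smaller = dist X Y / larger)"

end

theory Submission
  imports Defs
begin

text \<open>With \<open>u = A - B\<close>, \<open>v = C - B\<close>, a point of \<open>AD\<close> is \<open>B + u + t v\<close> with \<open>0 \<le> t \<le> 1\<close>, and it makes
  an angle of cosine \<open>1 / sqrt (1 + t\<^sup>2)\<close> with \<open>BA\<close>. Since \<open>cos \<beta> = 1 / sqrt 5\<close>, the half-angle formula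
  leaves only \<open>t = 1 / \<Phi>\<close>; for this \<open>t\<close> the angle with \<open>BF\<close> has the same cosine.\<close>

lemma angle_cosine_bounds:
  "\<bar>((X - Y) \<bullet> (Z - Y)) / (norm (X - Y) * norm (Z - Y))\<bar> \<le> 1"
  using Cauchy_Schwarz_ineq2[of "X - Y" "Z - Y"]
  by (cases "norm (X - Y) * norm (Z - Y) = 0") (auto simp: abs_mult divide_le_eq_1)

text \<open>Also true in the degenerate cases \<open>X = Y\<close> or \<open>Z = Y\<close>: the
  quotient is then 0 by division by zero, and its \<open>arccos\<close> is
  \<open>pi / 2\<close>.\<close>

lemma angle_eq_right_angle_iff: "angle X Y Z = pi / 2 \<longleftrightarrow> (X - Y) \<bullet> (Z - Y) = 0"
proof
  assume "angle X Y Z = pi / 2"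
  then have "((X - Y) \<bullet> (Z - Y)) / (norm (X - Y) * norm (Z - Y)) = 0"
    using cos_arccos_abs[OF angle_cosine_bounds[of X Y Z]] by (metis angle_def cos_pi_half)
  then show "(X - Y) \<bullet> (Z - Y) = 0" by auto
qed (simp add: angle_def)

text \<open>The double-angle formula for cosine. The condition \<open>0 \<le> x\<close> records that
  half of an angle in \<open>[0, pi]\<close> is at most \<open>pi / 2\<close>; the equation in
  \<open>x\<close> squared alone would not fix the sign of \<open>x\<close>.\<close>

lemma arccos_eq_half_arccos_iff:
  assumes "\<bar>x\<bar> \<le> 1" and "\<bar>y\<bar> \<le> 1"
  shows "arccos x = arccos y / 2 \<longleftrightarrow> 0 \<le> x \<and> 2 * x\<^sup>2 - 1 = y"
proof
  assume h: "arccos x = arccos y / 2"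
  have "0 \<le> arccos y" "arccos y \<le> pi"
    using assms arccos_lbound arccos_ubound by auto
  then have "0 \<le> cos (arccos x)"
    unfolding h by (intro cos_ge_zero) auto
  moreover have "cos (arccos y) = 2 * (cos (arccos x))\<^sup>2 - 1"
    using cos_double_cos[of "arccos x"] unfolding h by simp
  ultimately show "0 \<le> x \<and> 2 * x\<^sup>2 - 1 = y"
    using assms by simp
next
  assume h: "0 \<le> x \<and> 2 * x\<^sup>2 - 1 = y"
  have "y = cos (2 * arccos x)"
    using assms h by (simp add: cos_double_cos)
  moreover have "0 \<le> arccos x" "arccos x \<le> pi / 2"
    using assms h arccos_lbound arccos_le_pi2 by auto
  ultimately show "arccos x = arccos y / 2"
    by (simp add: arccos_cos)
qed

text \<open>Otherwise \<open>u\<close>, \<open>v\<close>, \<open>w\<close> would be three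
  independent vectors in a space of dimension 2. This is where planarity enters.\<close>

lemma orthogonal_to_basis_imp_zero:
  fixes u v w :: "real^2"
  assumes "u \<noteq> 0" "v \<noteq> 0" "u \<bullet> v = 0" "w \<bullet> u = 0" "w \<bullet> v = 0"
  shows "w = 0"
proof (rule ccontr)
  assume "w \<noteq> 0"
  have "pairwise orthogonal {u, v, w}"
    using assms by (auto simp: pairwise_def orthogonal_def inner_commute)
  then have "independent {u, v, w}"
    using assms \<open>w \<noteq> 0\<close> by (intro pairwise_orthogonal_independent) auto
  then have "card {u, v, w} \<le> 2"
    using independent_bound[of "{u, v, w}"] by simp
  moreover have "u \<noteq> v" "u \<noteq> w" "v \<noteq> w"
    using assms \<open>w \<noteq> 0\<close> by auto
  ultimately show False by simp
qed

text \<open>The right angles at \<open>A\<close>, \<open>B\<close> and \<open>C\<close> make the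
  difference of the two sides orthogonal to both sides at \<open>B\<close>.\<close>

lemma is_rectangle_imp_parallelogram:
  assumes "is_rectangle A B C D"
  shows "D - A = C - B"
proof -
  have "(D - A) \<bullet> (B - A) = 0" "(A - B) \<bullet> (C - B) = 0" "(B - C) \<bullet> (D - C) = 0"
    and ne: "A - B \<noteq> 0" "C - B \<noteq> 0"
    using assms unfolding is_rectangle_def angle_eq_right_angle_iff by auto
  then have "(D - A - (C - B)) \<bullet> (A - B) = 0" "(D - A - (C - B)) \<bullet> (C - B) = 0"
    by (simp_all add: inner_commute algebra_simps)
  then have "D - A - (C - B) = 0"
    by (rule orthogonal_to_basis_imp_zero[OF ne \<open>(A - B) \<bullet> (C - B) = 0\<close>])
  then show ?thesis by simp
qed

lemma is_rectangleI_parallelogram: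
  assumes "D - A = C - B" "(A - B) \<bullet> (C - B) = 0" "A \<noteq> B" "C \<noteq> B"
  shows "is_rectangle A B C D"
proof -
  define u v where "u = A - B" and "v = C - B"
  have uv: "u \<bullet> v = 0" "v \<bullet> u = 0" "u \<noteq> 0" "v \<noteq> 0"
    and pts: "A = B + u" "C = B + v" "D = B + u + v"
    using assms by (auto simp: u_def v_def inner_commute algebra_simps)
  \<comment> \<open>Needed for distinctness across the diagonals: \<open>A \<noteq> C\<close> and
    \<open>B \<noteq> D\<close>.\<close>
  have "u \<noteq> v" "u + v \<noteq> 0"
    using uv by (auto simp: add_eq_0_iff)
  then show ?thesis
    using uv unfolding is_rectangle_def angle_eq_right_angle_iff pts
    by (auto simp: algebra_simps)
qed

text \<open>The left side is the cosine of twice the angle whose tangent is \<open>t\<close>, and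
  \<open>1 / sqrt 5\<close> is the cosine of \<beta>.\<close>

lemma golden_equation_unique:
  fixes t :: real
  assumes "0 \<le> t"
  shows "2 / (1 + t\<^sup>2) - 1 = 1 / sqrt 5 \<longleftrightarrow> t = (sqrt 5 - 1) / 2"
proof -
  define r :: real where "r = sqrt 5"
  have r: "r\<^sup>2 = 5" "0 < r" "1 < r"
    by (simp_all add: r_def)
  have "1 + t\<^sup>2 \<noteq> 0"
    by (metis add_pos_nonneg less_irrefl zero_le_power2 zero_less_one)
  then have "2 / (1 + t\<^sup>2) - 1 = 1 / r \<longleftrightarrow> r * (1 - t\<^sup>2) = 1 + t\<^sup>2"
    using r by (auto simp: field_simps)
  \<comment> \<open>Solving for the square of \<open>t\<close> gives
    \<open>(r - 1) / (r + 1)\<close>, which is the square of \<open>(r - 1) / 2\<close> because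
    \<open>(r + 1) * (r - 1) = 4\<close>.\<close>
  also have "\<dots> \<longleftrightarrow> (r + 1) * (t\<^sup>2 - ((r - 1) / 2)\<^sup>2) = 0"
  proof -
    have "(r + 1) * ((r - 1) / 2)\<^sup>2 = (r\<^sup>2 - 1) * (r - 1) / 4"
      by (simp add: power2_eq_square field_simps)
    also have "\<dots> = r - 1" using r by simp
    finally show ?thesis by (simp add: algebra_simps) linarith
  qed
  also have "\<dots> \<longleftrightarrow> t = (r - 1) / 2"
    using r assms power2_eq_iff_nonneg[of t "(r - 1) / 2"] by simp
  finally show ?thesis by (simp add: r_def)
qed

theorem mainTheorem3:
  fixes A B C D E F :: "real^2"
  assumes "is_square A B C D"
    and "E = midpoint A B"
    and "F = midpoint C D"
  shows "is_rectangle E B C F \<and>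
    (\<exists>G. angle_bisector F B A \<inter> closed_segment A D = {G} \<and>
         divides_in_golden_section G A D \<and>
         dist A G / dist G D = golden_ratio \<and>
         dist A D / dist A G = golden_ratio)"
proof -
  define u v where "u = A - B" and "v = C - B"
  define s where "s = norm u"
  have rect: "is_rectangle A B C D" and sides: "dist A B = dist B C"
    using assms(1) by (auto simp: is_square_def)
  have uv: "u \<bullet> v = 0" "v \<bullet> u = 0" and "u \<noteq> 0" "v \<noteq> 0"
    using rect unfolding is_rectangle_def angle_eq_right_angle_iff u_def v_def
    by (auto simp: inner_commute)
  have s: "0 < s" "norm u = s" "norm v = s"
    using \<open>u \<noteq> 0\<close> sides by (auto simp: s_def u_def v_def dist_norm norm_minus_commute)
  have sq: "u \<bullet> u = s\<^sup>2" "v \<bullet> v = s\<^sup>2"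
    using s by (simp_all flip: power2_norm_eq_inner)
  have A: "A = B + u" and C: "C = B + v"
    by (simp_all add: u_def v_def)
  have D: "D = B + u + v"
    using is_rectangle_imp_parallelogram[OF rect] by (simp add: u_def v_def algebra_simps)
  have E: "E = B + (1/2) *\<^sub>R u" and F: "F = B + (1/2) *\<^sub>R u + v"
    unfolding assms(2,3) midpoint_def A C D
    by (simp_all add: vec_eq_iff field_simps)

  have rectE: "is_rectangle E B C F"
    using \<open>u \<noteq> 0\<close> \<open>v \<noteq> 0\<close> uv
    by (intro is_rectangleI_parallelogram) (auto simp: E F C)

  define P where "P t = B + u + t *\<^sub>R v" for t :: real
  define k where "k t = 1 / sqrt (1 + t\<^sup>2)" for t :: real
  have segment: "closed_segment A D = P ` {0..1}"
    unfolding closed_segment_image_interval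
    by (intro image_cong) (auto simp: P_def A D algebra_simps)
  have normP: "norm (P t - B) = s * sqrt (1 + t\<^sup>2)" for t
  proof -
    have "(norm (P t - B))\<^sup>2 = (s * sqrt (1 + t\<^sup>2))\<^sup>2"
      by (simp add: power2_norm_eq_inner P_def inner_add_left inner_add_right uv sq
          power_mult_distrib add_nonneg_nonneg) (simp add: power2_eq_square algebra_simps)
    then show ?thesis using s by (simp add: power2_eq_iff_nonneg)
  qed
  have normF: "norm (F - B) = s * (sqrt 5 / 2)"
  proof -
    have "(norm (F - B))\<^sup>2 = (s * (sqrt 5 / 2))\<^sup>2"
      by (simp add: power2_norm_eq_inner F inner_add_left inner_add_right uv sq
          power_mult_distrib power_divide)
    then show ?thesis using s by (simp add: power2_eq_iff_nonneg)
  qed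
  have normA: "norm (A - B) = s" by (simp add: A s)
  have angleFBA: "angle F B A = arccos (1 / sqrt 5)"
    unfolding angle_def normF normA
    using s by (simp add: F A inner_add_left uv sq power2_eq_square)
  have anglePBA: "angle (P t) B A = arccos (k t)" for t
    unfolding angle_def normP normA k_def
    using s by (simp add: P_def A inner_add_left uv sq power2_eq_square)
  have angleFBP: "angle F B (P t) = arccos ((1 + 2 * t) / sqrt 5 * k t)" for t
  proof -
    have "(F - B) \<bullet> (P t - B) = (s * s) * (1 / 2 + t)"
      by (simp add: F P_def inner_add_left inner_add_right uv sq power2_eq_square algebra_simps)
    moreover have "(s * s) * (1 / 2 + t) / (s * (sqrt 5 / 2) * (s * sqrt (1 + t\<^sup>2)))
        = (1 + 2 * t) / sqrt 5 * k t"
      using s by (simp add: k_def divide_simps)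
    ultimately show ?thesis
      by (simp only: angle_def normF normP)
  qed

  define g where "g = (sqrt 5 - 1) / (2::real)"
  \<comment> \<open>In this form the factor \<open>(1 + 2 * t) / sqrt 5\<close> in
    \<open>angleFBP\<close> is visibly 1 at \<open>t = g\<close>.\<close>
  have g5: "sqrt 5 = 1 + 2 * g" by (simp add: g_def field_simps)
  have gg: "g\<^sup>2 = 1 - g"
    by (simp add: g_def power2_eq_square field_simps)
  have "2 < sqrt (5::real)" "sqrt (5::real) < 3"
    by (simp_all add: real_less_rsqrt real_less_lsqrt)
  \<comment> \<open>The upper bound puts \<open>P g\<close> on the side \<open>AD\<close>; the lower
    bound makes \<open>AG\<close> the larger part.\<close>
  then have g: "1/2 < g" "g < 1" by (simp_all add: g_def)

  have half: "angle (P t) B A = angle F B A / 2 \<longleftrightarrow> t = g" if "0 \<le> t" for t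
  proof -
    have pos: "0 < 1 + t\<^sup>2" by (simp add: add_pos_nonneg)
    have "\<bar>k t\<bar> \<le> 1" "\<bar>1 / sqrt 5\<bar> \<le> (1::real)" "0 \<le> k t"
      using pos by (simp_all add: k_def)
    moreover have "2 * (k t)\<^sup>2 = 2 / (1 + t\<^sup>2)"
      using pos by (simp add: k_def power_divide)
    ultimately show ?thesis
      using golden_equation_unique[OF that] unfolding anglePBA angleFBA
      by (subst arccos_eq_half_arccos_iff) (auto simp: g_def)
  qed
  \<comment> \<open>The condition on the angle with \<open>BA\<close> already forces
    \<open>t = g\<close>, so the other half of the bisector condition is only checked there.\<close>
  have equal: "angle F B (P g) = angle (P g) B A"
    unfolding angleFBP anglePBA g5 using g by simp
  \<comment> \<open>The set \<open>angle_bisector F B A\<close> contains its vertex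
    \<open>B\<close>, which must not be counted as a point of \<open>AD\<close>.\<close>
  have "P t \<noteq> B" for t
  proof -
    have "0 < norm (P t - B)"
      unfolding normP using s by (simp add: add_pos_nonneg)
    then show ?thesis by auto
  qed
  then have bis: "P t \<in> angle_bisector F B A \<longleftrightarrow> t = g" if "0 \<le> t" for t
    using half[OF that] equal by (auto simp: angle_bisector_def)
  have inter: "angle_bisector F B A \<inter> closed_segment A D = {P g}"
    unfolding segment using bis g by auto

  have AG: "dist A (P g) = g * s"
    using g s by (simp add: dist_norm A P_def)
  have "P g - D = (g - 1) *\<^sub>R v"
    by (simp add: D P_def algebra_simps)
  then have GD: "dist (P g) D = (1 - g) * s"
    using g s by (simp add: dist_norm)
  have AD: "dist A D = s"
    using s by (simp add: dist_norm A D)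
  have "(1 + g) * g = 1" using gg by (simp add: power2_eq_square algebra_simps)
  then have "1 / g = 1 + g" using g by (simp add: field_simps)
  have ratio: "golden_ratio = 1 / g"
    unfolding \<open>1 / g = 1 + g\<close> by (simp add: golden_ratio_def g_def field_simps)
  \<comment> \<open>By \<open>gg\<close>, the denominator \<open>1 - g\<close> is the square of
    \<open>g\<close>.\<close>
  have "g / (1 - g) = 1 / g"
    using g by (simp flip: gg add: power2_eq_square)
  then have r1: "dist A (P g) / dist (P g) D = golden_ratio"
    and r2: "dist A D / dist A (P g) = golden_ratio"
    using s g by (simp_all add: AG GD AD ratio)
  have "P g \<noteq> A" "P g \<noteq> D"
    using AG GD g s by auto
  then have "P g \<in> open_segment A D"
    using inter by (auto simp: open_segment_def)
  \<comment> \<open>Decides the \<open>max\<close> and \<open>min\<close> in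
    \<open>divides_in_golden_section\<close>.\<close>
  moreover have "dist (P g) D \<le> dist A (P g)"
    unfolding AG GD using g s by (intro mult_right_mono) auto
  ultimately have "divides_in_golden_section (P g) A D"
    using r1 r2 by (simp add: divides_in_golden_section_def max_absorb1 min_absorb2)
  then show ?thesis
    using rectE inter r1 r2 by blast
qed

end
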